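(* Let $\ell>2$ be an odd prime and let $c\in\mathbb F_\ell^*$ be a quadratic nonresidue. Then $$\frac{1}{\ell-1}\sum_{A\in\mathbb F_\ell^*}K(A,cA)=-1.$$ Equivalently, for every fixed $k\in\mathbb F_\ell^*$, $$\frac{1}{\ell-1}\sum_{N\in\mathbb F_\ell^*}K(kN,ckN)=-1.$$
   Context: $\chi$ denotes the Legendre symbol modulo $\ell$ on $\mathbb F_\ell$, with $\chi(0)=0$, and $K(A,B)=\sum_{z\in\mathbb F_\ell}\chi\bigl((z^2-A)(z^2-B)\bigr)$. *)

theory Defs
  imports Complex_Main "HOL-Number_Theory.Number_Theory"
begin

text \<open>The field with \<open>l\<close> elements is the library's \<open>residue_ring\<close>, whose carrier consists of
  the integers \<open>0, \<dots>, l - 1\<close>. Field elements are therefore integers, and the library's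
  \<open>Legendre\<close> and \<open>QuadRes\<close> apply to them directly.\<close>

abbreviation FF :: "nat \<Rightarrow> int ring"
  where "FF l \<equiv> residue_ring (int l)"

abbreviation FF_star :: "nat \<Rightarrow> int set"
  where "FF_star l \<equiv> carrier (FF l) - {\<zero>\<^bsub>FF l\<^esub>}"

abbreviation chi :: "nat \<Rightarrow> int \<Rightarrow> int"
  where "chi l x \<equiv> Legendre x (int l)"

definition K :: "nat \<Rightarrow> int \<Rightarrow> int \<Rightarrow> int"
  where "K l A B =
    (\<Sum>z\<in>carrier (FF l).
      chi l ((z [^]\<^bsub>FF l\<^esub> (2::nat) \<ominus>\<^bsub>FF l\<^esub> A) \<otimes>\<^bsub>FF l\<^esub> (z [^]\<^bsub>FF l\<^esub> (2::nat) \<ominus>\<^bsub>FF l\<^esub> B)))"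

end

theory Submission
  imports Defs
begin

text \<open>
  Exchange the two summations: for each \<open>z\<close>, sum \<open>\<chi>((z\<^sup>2 - A)(z\<^sup>2 - cA))\<close> over the nonzero \<open>A\<close>.

  For \<open>z = 0\<close> every summand is \<open>\<chi>(cA\<^sup>2) = \<chi>(c) = -1\<close>, so this column contributes \<open>-(l - 1)\<close>.
  Every other column vanishes by a symmetry. The permutation \<open>A \<mapsto> z\<^sup>4 / (cA)\<close> of the nonzero
  residues swaps the two factors up to scaling: with \<open>B = z\<^sup>4 / (cA)\<close>,
  \<open>cA\<^sup>2 (z\<^sup>2 - B)(z\<^sup>2 - cB) = z\<^sup>4 (z\<^sup>2 - A)(z\<^sup>2 - cA)\<close>,
  and since \<open>A\<^sup>2\<close> and \<open>z\<^sup>4\<close> are nonzero squares while \<open>c\<close> is a nonresidue, passing from \<open>A\<close> to \<open>B\<close>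
  changes the sign of the summand. A sum that a permutation of its index set negates is zero.

  The version with a parameter \<open>k\<close> is the same sum, because multiplication by \<open>k\<close> permutes the
  nonzero residues. The character sums are computed with integers modulo \<open>l\<close>;
  \<open>K_eq\<close> is the passage from the ring operations, \<open>Legendre_sum_column\<close> the vanishing of a column,
  and \<open>sum_K_nonresidue\<close> the total.
\<close>

lemma FF_star_eq: "FF_star l = {0<..<int l}"
  by (auto simp: residue_ring_def)

lemma FF_star_coprime:
  assumes "prime l" "A \<in> FF_star l"
  shows "coprime A (int l)"
  using assms zdvd_not_zless prime_imp_coprime[of "int l" A]
  by (auto simp: FF_star_eq ac_simps)

lemma Legendre_cong: "[a = b] (mod p) \<Longrightarrow> Legendre a p = Legendre b p"
  by (simp add: Legendre_def QuadRes_def cong_def)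

text \<open>
  By Euler's criterion both sides are congruent to \<open>(ab)\<^bsup>(p - 1) / 2\<^esup>\<close>; two numbers in
  \<open>{-1, 0, 1}\<close> that are congruent modulo \<open>p > 2\<close> coincide.
\<close>
lemma Legendre_mult:
  assumes "prime p" "p > 2"
  shows "Legendre (a * b) (int p) = Legendre a (int p) * Legendre b (int p)"
proof -
  define h where "h = (p - 1) div 2"
  have euler: "[Legendre x (int p) = x ^ h] (mod int p)" for x
    unfolding h_def using euler_criterion[of p x] assms by auto
  have "[Legendre (a * b) (int p) = a ^ h * b ^ h] (mod int p)"
    using euler[of "a * b"] by (simp add: power_mult_distrib)
  also have "[a ^ h * b ^ h = Legendre a (int p) * Legendre b (int p)] (mod int p)"
    by (intro cong_mult cong_sym[OF euler])
  finally have "int p dvd Legendre (a * b) (int p) - Legendre a (int p) * Legendre b (int p)"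
    by (simp add: cong_iff_dvd_diff)
  moreover have "\<bar>Legendre (a * b) (int p) - Legendre a (int p) * Legendre b (int p)\<bar> < int p"
    using assms(2) by (simp add: Legendre_def)
  ultimately show ?thesis
    using zdvd_not_zless[of "\<bar>Legendre (a * b) (int p) - Legendre a (int p) * Legendre b (int p)\<bar>" "int p"]
    by force
qed

lemma Legendre_square:
  assumes "coprime x p" "\<bar>p\<bar> > 1"
  shows "Legendre (x\<^sup>2) p = 1"
proof -
  have "\<not> p dvd x\<^sup>2"
    using assms coprime_common_divisor[of "x\<^sup>2" p p] by auto
  then show ?thesis
    by (auto simp: Legendre_def cong_0_iff QuadRes_def intro: exI[of _ x])
qed

lemma K_eq:
  assumes "prime l"
  shows "K l A B = (\<Sum>z\<in>{0..<int l}. Legendre ((z\<^sup>2 - A) * (z\<^sup>2 - B)) (int l))"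
proof -
  interpret residues_prime l "FF l" by unfold_locales (fact assms, simp)
  have sq: "z [^]\<^bsub>FF l\<^esub> (2::nat) = z\<^sup>2 mod int l" if "z \<in> {0..<int l}" for z
    using that pow_cong[of z 2] by simp
  have diff: "x mod int l \<ominus>\<^bsub>FF l\<^esub> y = (x - y) mod int l" for x y
    unfolding a_minus_def res_neg_eq res_add_eq mod_add_eq by simp
  have arg: "(z [^]\<^bsub>FF l\<^esub> (2::nat) \<ominus>\<^bsub>FF l\<^esub> A) \<otimes>\<^bsub>FF l\<^esub> (z [^]\<^bsub>FF l\<^esub> (2::nat) \<ominus>\<^bsub>FF l\<^esub> B)
      = ((z\<^sup>2 - A) * (z\<^sup>2 - B)) mod int l" if "z \<in> {0..<int l}" for z
    unfolding sq[OF that] diff mult_cong ..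
  show ?thesis
    unfolding K_def
  proof (rule sum.cong)
    show "carrier (FF l) = {0..<int l}"
      by (auto simp: res_carrier_eq)
    show "chi l ((z [^]\<^bsub>FF l\<^esub> (2::nat) \<ominus>\<^bsub>FF l\<^esub> A) \<otimes>\<^bsub>FF l\<^esub> (z [^]\<^bsub>FF l\<^esub> (2::nat) \<ominus>\<^bsub>FF l\<^esub> B))
        = chi l ((z\<^sup>2 - A) * (z\<^sup>2 - B))" if "z \<in> {0..<int l}" for z
      unfolding arg[OF that] by (rule Legendre_cong) simp
  qed
qed

text \<open>
  The map \<open>g\<close> is \<open>A \<mapsto> e / (cA)\<close>. It is specified by a congruence so that its use in a character
  sum needs no division modulo \<open>l\<close>.
\<close>
lemma twisted_inversion_exists:
  assumes "prime l" "coprime c (int l)" "coprime e (int l)"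
  obtains g where "bij_betw g (FF_star l) (FF_star l)"
    and "\<And>A. A \<in> FF_star l \<Longrightarrow> [c * A * g A = e] (mod int l)"
proof -
  have "\<exists>B\<in>FF_star l. [c * A * B = e] (mod int l)" if A: "A \<in> FF_star l" for A
  proof -
    obtain y where y: "[c * A * y = 1] (mod int l)"
      using assms FF_star_coprime[OF assms(1) A] cong_solve_coprime_int[of "c * A" "int l"] by auto
    let ?B = "(y * e) mod int l"
    have "[c * A * ?B = c * A * (y * e)] (mod int l)"
      by (intro cong_mult cong_refl) simp
    also have "[c * A * (y * e) = e] (mod int l)"
      using cong_mult[OF y cong_refl[of e]] by (simp add: mult.assoc)
    finally have B: "[c * A * ?B = e] (mod int l)" .
    moreover have "?B \<noteq> 0"
    proof
      assume "?B = 0"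
      with B have "int l dvd e" by (simp add: cong_def dvd_eq_mod_eq_0)
      with assms show False
        using not_prime_1 by (auto dest: coprime_common_divisor)
    qed
    moreover have "0 \<le> ?B" "?B < int l"
      using assms(1) by (simp_all add: prime_gt_0_nat)
    ultimately show ?thesis
      by (intro bexI[of _ ?B]) (auto simp: FF_star_eq)
  qed
  then obtain g where g: "\<And>A. A \<in> FF_star l \<Longrightarrow> g A \<in> FF_star l"
    "\<And>A. A \<in> FF_star l \<Longrightarrow> [c * A * g A = e] (mod int l)"
    by metis
  have "inj_on g (FF_star l)"
  proof (rule inj_onI)
    fix A B assume AB: "A \<in> FF_star l" "B \<in> FF_star l" "g A = g B"
    have "[(c * g A) * A = (c * g A) * B] (mod int l)"
      using cong_trans[OF g(2)[OF AB(1)] cong_sym[OF g(2)[OF AB(2)]]] AB(3)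
      by (simp add: ac_simps)
    moreover have "coprime (c * g A) (int l)"
      using assms FF_star_coprime[OF assms(1) g(1)[OF AB(1)]] by simp
    ultimately have "[A = B] (mod int l)"
      by (simp only: cong_mult_lcancel)
    then show "A = B"
      using AB by (auto simp: FF_star_eq cong_def)
  qed
  moreover have "finite (FF_star l)" by (simp add: FF_star_eq)
  ultimately have "bij_betw g (FF_star l) (FF_star l)"
    using g(1) by (intro bij_betw_imageI endo_inj_surj image_subsetI)
  with g(2) show thesis using that by blast
qed

lemma sum_eq_zero_if_bij_negates:
  fixes f :: "'a \<Rightarrow> int"
  assumes "bij_betw g S S" "\<And>x. x \<in> S \<Longrightarrow> f (g x) = - f x"
  shows "sum f S = 0"
proof -
  have "sum f S = (\<Sum>x\<in>S. f (g x))"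
    using sum.reindex_bij_betw[OF assms(1)] by metis
  also have "\<dots> = - sum f S"
    using assms(2) by (simp add: sum_negf)
  finally show ?thesis by simp
qed

text \<open>
  The inversion \<open>g A = z\<^sup>4 / (cA)\<close> is chosen because it exchanges the roots \<open>z\<^sup>2\<close> and \<open>z\<^sup>2 / c\<close> of
  the quadratic polynomial in \<open>A\<close>. The polynomial is therefore reproduced up to the factor \<open>c\<close> and
  squares, and \<open>\<chi>(c) = -1\<close> makes the inversion negate each summand.
\<close>
lemma Legendre_sum_column:
  assumes "prime l" "l > 2" "Legendre c (int l) = -1" "coprime z (int l)"
  shows "(\<Sum>A\<in>FF_star l. Legendre ((z\<^sup>2 - A) * (z\<^sup>2 - c * A)) (int l)) = 0"
proof -
  have c: "coprime c (int l)"
    using assms(1,3) prime_imp_coprime[of "int l" c]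
    by (auto simp: Legendre_def cong_0_iff ac_simps split: if_splits)
  obtain g where bij: "bij_betw g (FF_star l) (FF_star l)"
    and g: "\<And>A. A \<in> FF_star l \<Longrightarrow> [c * A * g A = z ^ 4] (mod int l)"
    using twisted_inversion_exists[of l c "z ^ 4"] assms c by auto
  show ?thesis
  proof (rule sum_eq_zero_if_bij_negates[OF bij])
    fix A assume A: "A \<in> FF_star l"
    let ?P = "\<lambda>A. (z\<^sup>2 - A) * (z\<^sup>2 - c * A)"
    \<comment> \<open>One factor \<open>A\<close> goes into each bracket and \<open>c\<close> into the first, so that \<open>g A\<close> occurs only in
      the product \<open>c * A * g A\<close>, whose residue is known.\<close>
    have "c * A\<^sup>2 * ?P (g A) = (c * A * z\<^sup>2 - c * A * g A) * (A * z\<^sup>2 - c * A * g A)"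
      by (simp add: algebra_simps power2_eq_square)
    also have "[\<dots> = (c * A * z\<^sup>2 - z ^ 4) * (A * z\<^sup>2 - z ^ 4)] (mod int l)"
      by (intro cong_mult cong_diff cong_refl g A)
    also have "(c * A * z\<^sup>2 - z ^ 4) * (A * z\<^sup>2 - z ^ 4) = (z\<^sup>2)\<^sup>2 * ?P A"
      by (simp add: algebra_simps power2_eq_square power4_eq_xxxx)
    finally have "Legendre (c * A\<^sup>2 * ?P (g A)) (int l) = Legendre ((z\<^sup>2)\<^sup>2 * ?P A) (int l)"
      by (rule Legendre_cong)
    moreover have "Legendre (A\<^sup>2) (int l) = 1"
      using FF_star_coprime[OF assms(1) A] assms(2) by (simp add: Legendre_square)
    moreover have "Legendre ((z\<^sup>2)\<^sup>2) (int l) = 1"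
      using assms(2,4) by (intro Legendre_square) auto
    ultimately show "Legendre (?P (g A)) (int l) = - Legendre (?P A) (int l)"
      using assms(3) by (simp add: Legendre_mult[OF assms(1,2)] del: mult_minus_left)
  qed
qed

text \<open>
  After exchanging the summations only the column \<open>z = 0\<close> survives, and there each of the \<open>l - 1\<close>
  summands is \<open>\<chi>(cA\<^sup>2) = -1\<close>.
\<close>
lemma sum_K_nonresidue:
  assumes "prime l" "l > 2" "Legendre c (int l) = -1"
  shows "(\<Sum>A\<in>FF_star l. K l A (c \<otimes>\<^bsub>FF l\<^esub> A)) = - (int l - 1)"
proof -
  let ?f = "\<lambda>z A. Legendre ((z\<^sup>2 - A) * (z\<^sup>2 - c * A)) (int l)"
  have "K l A (c \<otimes>\<^bsub>FF l\<^esub> A) = (\<Sum>z\<in>{0..<int l}. ?f z A)" for A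
    unfolding K_eq[OF assms(1)]
    by (intro sum.cong refl Legendre_cong cong_mult cong_diff)
       (auto simp: residue_ring_def cong_def)
  then have "(\<Sum>A\<in>FF_star l. K l A (c \<otimes>\<^bsub>FF l\<^esub> A)) = (\<Sum>z\<in>{0..<int l}. \<Sum>A\<in>FF_star l. ?f z A)"
    using sum.swap[of "\<lambda>A z. ?f z A" "{0..<int l}" "FF_star l"] by simp
  also have "{0..<int l} = insert 0 (FF_star l)"
    using assms by (auto simp: FF_star_eq)
  also have "(\<Sum>z\<in>insert 0 (FF_star l). \<Sum>A\<in>FF_star l. ?f z A) =
      (\<Sum>A\<in>FF_star l. ?f 0 A) + (\<Sum>z\<in>FF_star l. \<Sum>A\<in>FF_star l. ?f z A)"
    by (rule sum.insert) (auto simp: FF_star_eq)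
  also have "(\<Sum>z\<in>FF_star l. \<Sum>A\<in>FF_star l. ?f z A) = 0"
    using Legendre_sum_column[OF assms] FF_star_coprime[OF assms(1)] by (intro sum.neutral) blast
  also have "?f 0 A = -1" if A: "A \<in> FF_star l" for A
  proof -
    have "?f 0 A = Legendre (c * A\<^sup>2) (int l)"
      by (simp add: algebra_simps power2_eq_square)
    then show ?thesis
      using assms Legendre_square[OF FF_star_coprime[OF assms(1) A]] by (simp add: Legendre_mult)
  qed
  then have "(\<Sum>A\<in>FF_star l. ?f 0 A) = - int (card (FF_star l))" by simp
  also have "int (card (FF_star l)) = int l - 1"
    using assms(2) by (simp add: FF_star_eq)
  finally show ?thesis by simp
qed

lemma bij_betw_FF_star_mult:
  assumes "prime l" "k \<in> FF_star l"
  shows "bij_betw (\<lambda>N. k \<otimes>\<^bsub>FF l\<^esub> N) (FF_star l) (FF_star l)"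
proof -
  interpret residues_prime l "FF l" by unfold_locales (fact assms, simp)
  have inj: "inj_on (\<lambda>N. k \<otimes>\<^bsub>FF l\<^esub> N) (FF_star l)"
    using assms(2) by (intro inj_onI) (metis DiffD1 DiffD2 m_lcancel singletonI)
  have "(\<lambda>N. k \<otimes>\<^bsub>FF l\<^esub> N) ` FF_star l \<subseteq> FF_star l"
  proof (rule image_subsetI)
    fix N assume N: "N \<in> FF_star l"
    show "k \<otimes>\<^bsub>FF l\<^esub> N \<in> FF_star l"
      using N assms(2) integral_iff[of k N] m_closed[of k N] by simp
  qed
  moreover have "Finite_Set.finite (FF_star l)"
    by (simp add: FF_star_eq)
  ultimately show ?thesis
    using inj by (intro bij_betw_imageI endo_inj_surj)
qed

theorem lemma6p11:
  fixes l :: nat and c :: int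
  assumes "prime l" and "l > 2"
    and "c \<in> FF_star l" and "\<not> QuadRes (int l) c"
  shows "1 / (real l - 1) * (\<Sum>A\<in>FF_star l. real_of_int (K l A (c \<otimes>\<^bsub>FF l\<^esub> A))) = -1
    \<and> (\<forall>k\<in>FF_star l.
        1 / (real l - 1) *
          (\<Sum>N\<in>FF_star l.
            real_of_int (K l (k \<otimes>\<^bsub>FF l\<^esub> N) (c \<otimes>\<^bsub>FF l\<^esub> k \<otimes>\<^bsub>FF l\<^esub> N))) = -1)"
proof -
  interpret residues_prime l "FF l" by unfold_locales (fact assms, simp)
  let ?F = "\<lambda>A. real_of_int (K l A (c \<otimes>\<^bsub>FF l\<^esub> A))"
  have "Legendre c (int l) = -1"
    using assms(3,4) by (auto simp: FF_star_eq Legendre_def cong_def)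
  then have "(\<Sum>A\<in>FF_star l. ?F A) = real_of_int (- (int l - 1))"
    using sum_K_nonresidue[OF assms(1,2)] by (simp only: of_int_sum[symmetric])
  then have mean: "1 / (real l - 1) * (\<Sum>A\<in>FF_star l. ?F A) = -1"
    using assms(2) by (simp only:) (simp add: field_simps)
  have reindex: "(\<Sum>N\<in>FF_star l. real_of_int (K l (k \<otimes>\<^bsub>FF l\<^esub> N) (c \<otimes>\<^bsub>FF l\<^esub> k \<otimes>\<^bsub>FF l\<^esub> N)))
      = (\<Sum>A\<in>FF_star l. ?F A)" if k: "k \<in> FF_star l" for k
  proof -
    have "c \<otimes>\<^bsub>FF l\<^esub> k \<otimes>\<^bsub>FF l\<^esub> N = c \<otimes>\<^bsub>FF l\<^esub> (k \<otimes>\<^bsub>FF l\<^esub> N)" if "N \<in> FF_star l" for N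
      using that k assms(3) by (intro m_assoc) blast+
    then have "(\<Sum>N\<in>FF_star l. real_of_int (K l (k \<otimes>\<^bsub>FF l\<^esub> N) (c \<otimes>\<^bsub>FF l\<^esub> k \<otimes>\<^bsub>FF l\<^esub> N)))
        = (\<Sum>N\<in>FF_star l. ?F (k \<otimes>\<^bsub>FF l\<^esub> N))"
      by (intro sum.cong refl) (simp only:)
    also have "\<dots> = (\<Sum>A\<in>FF_star l. ?F A)"
      by (rule sum.reindex_bij_betw[OF bij_betw_FF_star_mult[OF assms(1) k]])
    finally show ?thesis .
  qed
  show ?thesis
    by (intro conjI ballI mean) (simp only: reindex mean)
qed

end
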